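(* Let $G$ be a connected bipartite graph on the vertex set $V=\{1,\dots,n\}$, $n\ge 2$, with bipartition $(A,B)$, and let $\mathbf a=(a_1,\dots,a_n)\in\mathbb N^n$ with $\mathbf a\ne 0$. Then $\mathbf a$ is a solution of the system $$( * )\qquad \sum_{i\in A}a_i=\sum_{i\in B}a_i,\qquad \sum_{i\in C}a_i>\sum_{i\in A}a_i\ \text{ for all } C\in\operatorname{Min}(G),\ C\ne A,B,$$ if and only if the following two conditions are satisfied: (1) $\operatorname{supp}(\mathbf a)$ is a dominating set of $G$; (2) $G^{\mathbf a}$ is a matching-covered graph.
   Context: All graphs are finite and simple; $\mathbb N$ includes $0$. $\operatorname{Min}(G)$ is the set of (inclusion-)minimal vertex covers of $G$. $\operatorname{supp}(\mathbf a)=\{i\mid a_i\ne 0\}$. A set $U\subseteq V$ is a dominating set of $G$ if every vertex of $V\setminus U$ is adjacent to a vertex of $U$. The $\mathbf a$-parallelization $G^{\mathbf a}$ of $G$ is the graph obtained from $G$ by deleting the vertices $i$ with $a_i=0$ and replacing every vertex $i$ with $a_i>0$ by vertices $i_1,\dots,i_{a_i}$, where $\{i_r,j_s\}$ is an edge of $G^{\mathbf a}$ if and only if $\{i,j\}$ is an edge of $G$. A graph is matching-covered if it is connected, is not an isolated vertex, and every edge is contained in a perfect matching. *)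

theory Defs
  imports "Graph_Theory.Digraph_Component" "Graph_Theory.Pair_Digraph"
begin

text \<open>
  A finite simple graph is a \<open>pair_graph\<close>: the arc set is a finite symmetric irreflexive
  relation on a finite vertex set, and the arcs \<open>(u, v)\<close>, \<open>(v, u)\<close> together represent the
  undirected edge \<open>{u, v}\<close>.
\<close>

definition edges :: "'a pair_pre_digraph \<Rightarrow> 'a set set" where
  "edges G = {{u, v} | u v. (u, v) \<in> parcs G}"

definition bipartition :: "'a pair_pre_digraph \<Rightarrow> 'a set \<Rightarrow> 'a set \<Rightarrow> bool" where
  "bipartition G A B \<longleftrightarrow> A \<union> B = pverts G \<and> A \<inter> B = {} \<and>
     (\<forall>e \<in> edges G. \<exists>u \<in> A. \<exists>v \<in> B. e = {u, v})"

definition vertex_cover :: "'a pair_pre_digraph \<Rightarrow> 'a set \<Rightarrow> bool" where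
  "vertex_cover G C \<longleftrightarrow> C \<subseteq> pverts G \<and> (\<forall>e \<in> edges G. e \<inter> C \<noteq> {})"

definition min_vertex_covers :: "'a pair_pre_digraph \<Rightarrow> 'a set set" where
  "min_vertex_covers G = {C. vertex_cover G C \<and> (\<forall>D. D \<subset> C \<longrightarrow> \<not> vertex_cover G D)}"

definition dominating_set :: "'a pair_pre_digraph \<Rightarrow> 'a set \<Rightarrow> bool" where
  "dominating_set G U \<longleftrightarrow> U \<subseteq> pverts G \<and>
     (\<forall>v \<in> pverts G - U. \<exists>u \<in> U. {u, v} \<in> edges G)"

definition perfect_matching :: "'a pair_pre_digraph \<Rightarrow> 'a set set \<Rightarrow> bool" where
  "perfect_matching G M \<longleftrightarrow> M \<subseteq> edges G \<and> pairwise disjnt M \<and> \<Union>M = pverts G"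

text \<open>\<open>Digraph_Component.connected\<close> ignores arc directions and requires a nonempty vertex set.\<close>

definition matching_covered :: "'a pair_pre_digraph \<Rightarrow> bool" where
  "matching_covered G \<longleftrightarrow> Digraph_Component.connected (with_proj G) \<and>
     \<not> (\<exists>v. pverts G = {v}) \<and>
     (\<forall>e \<in> edges G. \<exists>M. perfect_matching G M \<and> e \<in> M)"

text \<open>
  A vector in \<open>\<nat>\<^sup>V\<close> is a function whose values outside the vertex set \<open>V\<close> are irrelevant,
  so the support only records indices in \<open>V\<close>.
\<close>

definition supp :: "'a set \<Rightarrow> ('a \<Rightarrow> nat) \<Rightarrow> 'a set" where
  "supp V a = {i \<in> V. a i \<noteq> 0}"

text \<open>The copy \<open>i\<^sub>r\<close> of the vertex \<open>i\<close> is the pair \<open>(i, r)\<close>.\<close>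

definition parallelization ::
  "'a pair_pre_digraph \<Rightarrow> ('a \<Rightarrow> nat) \<Rightarrow> ('a \<times> nat) pair_pre_digraph" where
  "parallelization G a =
     \<lparr> pverts = (SIGMA i : pverts G. {1..a i}),
       parcs = {((i, r), (j, s)) | i r j s.
                  (i, j) \<in> parcs G \<and> r \<in> {1..a i} \<and> s \<in> {1..a j}} \<rparr>"

lemma pair_graph_parallelization:
  assumes "pair_graph G"
  shows "pair_graph (parallelization G a)"
proof -
  interpret pair_graph G by fact
  let ?P = "parallelization G a"
  have wf: "parcs ?P \<subseteq> pverts ?P \<times> pverts ?P"
    by (auto simp: parallelization_def dest: in_arcsD1 in_arcsD2)
  have fin: "finite (pverts ?P)"
    by (simp add: parallelization_def)
  have "finite (parcs ?P)"
    using finite_subset[OF wf] fin by blast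
  moreover have "sym (parcs ?P)"
    using pair_sym_arcs
    by (auto simp: parallelization_def symmetric_def sym_def)
  moreover have "fst e \<noteq> snd e" if "e \<in> parcs ?P" for e
    using that pair_no_loops by (fastforce simp: parallelization_def)
  ultimately show ?thesis
    using wf fin by unfold_locales (auto simp: symmetric_def)
qed

end

theory Submission
  imports Defs
begin

text \<open>
  A nonempty bipartite graph with parts \<open>A\<close>, \<open>B\<close> is matching-covered iff \<open>card A = card B\<close> and
  \<open>A\<close>, \<open>B\<close> are its only vertex covers of size at most \<open>card A\<close>. For such a cover \<open>C\<close> of a
  matching-covered graph, every edge lies in a perfect matching and hence meets \<open>C\<close> exactly once,
  so \<open>u \<in> C \<longleftrightarrow> u \<in> A\<close> has the same truth value at both ends of each edge, and by connectedness
  everywhere. Conversely, the covers \<open>(A - S) \<union> N(S)\<close> give \<open>card S < card (N(S))\<close> for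
  nonempty \<open>S \<subset> A\<close>, so Hall's condition survives the removal of the ends of any edge.

  For the parallelization, a cover contains all copies of some cover of \<open>G\<close>, namely of the
  vertices whose copies it contains completely. Domination serves to recover a minimal cover of
  \<open>G\<close> from its copies, which do not see the vertices of weight zero.
\<close>

section \<open>Hall's marriage theorem\<close>

text \<open>Pairs are deleted from \<open>R\<close> as long as Hall's condition survives. When no
  element of \<open>X\<close> has two partners left, singletons give existence of a partner and
  two-element sets give injectivity.\<close>

lemma hall_marriage:
  assumes "finite R" "finite X"
    and "\<And>S. S \<subseteq> X \<Longrightarrow> card S \<le> card (R `` S)"
  shows "\<exists>f. inj_on f X \<and> (\<forall>x\<in>X. (x, f x) \<in> R)"
  using assms(1,3)
proof (induction R rule: finite_psubset_induct)
  case (psubset R)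
  have finR: "finite (R `` S)" for S
    using psubset.hyps by (rule finite_Image)
  show ?case
  proof (cases "\<exists>x\<in>X. \<exists>y z. (x, y) \<in> R \<and> (x, z) \<in> R \<and> y \<noteq> z")
    case False
    have ex: "\<exists>y. (x, y) \<in> R" if "x \<in> X" for x
      using psubset.prems[of "{x}"] that finR[of "{x}"] by (fastforce simp: Suc_le_eq card_gt_0_iff)
    then obtain f where f: "\<And>x. x \<in> X \<Longrightarrow> (x, f x) \<in> R"
      by metis
    have uniq: "w = f x" if "x \<in> X" "(x, w) \<in> R" for x w
      using False f that by blast
    have "x = y" if "x \<in> X" "y \<in> X" "f x = f y" for x y
    proof (rule ccontr)
      assume "x \<noteq> y"
      have "R `` {x, y} \<subseteq> {f x}"
        using uniq that by fastforce
      then have "card (R `` {x, y}) \<le> 1"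
        using card_mono[of "{f x}"] by simp
      then show False
        using psubset.prems[of "{x, y}"] that \<open>x \<noteq> y\<close> by simp
    qed
    then show ?thesis
      using f by (auto simp: inj_on_def)
  next
    case True
    then obtain x y z where xyz: "x \<in> X" "(x, y) \<in> R" "(x, z) \<in> R" "y \<noteq> z"
      by blast
    \<comment> \<open>Rado's argument: if neither \<open>(x, y)\<close> nor \<open>(x, z)\<close> can be dropped, then the two violating
      sets contradict the submodularity of \<open>S \<mapsto> card (R `` S)\<close>.\<close>
    have removable: "\<exists>f. inj_on f X \<and> (\<forall>x\<in>X. (x, f x) \<in> R)"
      if "(x, w) \<in> R" "\<And>S. S \<subseteq> X \<Longrightarrow> card S \<le> card ((R - {(x, w)}) `` S)" for w
      using psubset.IH[of "R - {(x, w)}"] that by blast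
    \<comment> \<open>A set violated by the deletion of \<open>(x, w)\<close> must contain
      \<open>x\<close>, as its image would otherwise be unchanged. Taking \<open>x\<close> out of it
      lowers the strict bound by one, hence \<open>\<le>\<close>.\<close>
    have shrink: "\<exists>T. T \<subseteq> X - {x} \<and> card (R `` T \<union> (R `` {x} - {w})) \<le> card T"
      if S: "S \<subseteq> X" "\<not> card S \<le> card ((R - {(x, w)}) `` S)" for S w
    proof -
      have "x \<in> S"
      proof (rule ccontr)
        assume "x \<notin> S"
        then have "(R - {(x, w)}) `` S = R `` S" by auto
        with S psubset.prems show False by simp
      qed
      have "R `` (S - {x}) \<union> (R `` {x} - {w}) \<subseteq> (R - {(x, w)}) `` S"
        using \<open>x \<in> S\<close> by auto
      then have "card (R `` (S - {x}) \<union> (R `` {x} - {w})) \<le> card ((R - {(x, w)}) `` S)"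
        using psubset.hyps by (intro card_mono finite_Image) auto
      moreover have "card S = Suc (card (S - {x}))"
        using \<open>x \<in> S\<close> finite_subset[OF S(1) assms(2)] by (metis card_Suc_Diff1)
      ultimately have "card (R `` (S - {x}) \<union> (R `` {x} - {w})) \<le> card (S - {x})"
        using S(2) by linarith
      with S(1) show ?thesis by blast
    qed
    show ?thesis
    proof (rule ccontr)
      assume no: "\<not> ?thesis"
      have violating: "\<exists>T. T \<subseteq> X - {x} \<and> card (R `` T \<union> (R `` {x} - {w})) \<le> card T"
        if w: "(x, w) \<in> R" for w
      proof -
        obtain S where "S \<subseteq> X" "\<not> card S \<le> card ((R - {(x, w)}) `` S)"
          using removable[OF w] no by meson
        then show ?thesis by (rule shrink)
      qed
      obtain S where S: "S \<subseteq> X - {x}" "card (R `` S \<union> (R `` {x} - {y})) \<le> card S"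
        using violating[OF xyz(2)] by blast
      obtain T where T: "T \<subseteq> X - {x}" "card (R `` T \<union> (R `` {x} - {z})) \<le> card T"
        using violating[OF xyz(3)] by blast
      let ?P = "R `` S \<union> (R `` {x} - {y})" and ?Q = "R `` T \<union> (R `` {x} - {z})"
      have finST: "finite S" "finite T"
        using S T assms(2) by (auto intro: finite_subset)
      \<comment> \<open>Since \<open>y\<close> and \<open>z\<close> differ, each of the two sets
        restores the partner of \<open>x\<close> missing from the other. Hall's condition for
        \<open>insert x (S \<union> T)\<close> and for \<open>S \<inter> T\<close> then makes
        \<open>card ?P + card ?Q\<close> at least \<open>card S + card T + 1\<close>.\<close>
      have "R `` insert x (S \<union> T) \<subseteq> ?P \<union> ?Q"
        using xyz by auto
      then have "card (insert x (S \<union> T)) \<le> card (?P \<union> ?Q)"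
        using psubset.prems[of "insert x (S \<union> T)"] S T xyz(1) finR
        by (meson card_mono finite_Diff finite_UnI insert_subsetI le_trans Un_least
            subset_trans Diff_subset)
      moreover have "card (insert x (S \<union> T)) = Suc (card (S \<union> T))"
        using S T finST by (subst card_insert_disjoint) auto
      moreover have "R `` (S \<inter> T) \<subseteq> ?P \<inter> ?Q"
        by auto
      then have "card (S \<inter> T) \<le> card (?P \<inter> ?Q)"
        using psubset.prems[of "S \<inter> T"] S finR
        by (meson Diff_subset card_mono finite_Diff finite_Int finite_UnI le_infI1 le_trans subset_trans)
      moreover have "card ?P + card ?Q = card (?P \<union> ?Q) + card (?P \<inter> ?Q)"
        using finR by (intro card_Un_Int) auto
      moreover have "card S + card T = card (S \<union> T) + card (S \<inter> T)"
        using finST by (rule card_Un_Int)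
      ultimately show False
        using S T by linarith
    qed
  qed
qed

section \<open>Connectedness, bipartitions and vertex covers in terms of arcs\<close>

context pair_graph
begin

lemma parcs_sym: "(u, v) \<in> parcs G \<Longrightarrow> (v, u) \<in> parcs G"
  using pair_sym_arcs by (auto simp: symmetric_def sym_def)

lemma edge_iff: "{u, v} \<in> edges G \<longleftrightarrow> (u, v) \<in> parcs G"
  using parcs_sym by (auto simp: edges_def doubleton_eq_iff)

lemma connected_iff_rtrancl:
  "Digraph_Component.connected (with_proj G) \<longleftrightarrow>
    pverts G \<noteq> {} \<and> (\<forall>u\<in>pverts G. \<forall>v\<in>pverts G. (u, v) \<in> (parcs G)\<^sup>*)"
proof -
  have "u \<rightarrow>\<^sup>*\<^bsub>with_proj G\<^esub> v \<longleftrightarrow> (u, v) \<in> (parcs G)\<^sup>*" if "u \<in> pverts G" for u v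
  proof
    assume "(u, v) \<in> (parcs G)\<^sup>*"
    then show "u \<rightarrow>\<^sup>*\<^bsub>with_proj G\<^esub> v"
      using that by (induction) (auto intro: reachable_adj_trans)
  qed (auto dest: reachable_rtranclI)
  then show ?thesis
    by (auto simp: connected_def strongly_connected_def reachable_mk_symmetric_eq[OF pair_sym_arcs])
qed

lemma vertex_cover_iff:
  "vertex_cover G C \<longleftrightarrow> C \<subseteq> pverts G \<and> (\<forall>u v. (u, v) \<in> parcs G \<longrightarrow> u \<in> C \<or> v \<in> C)"
proof -
  have "(\<forall>e\<in>edges G. e \<inter> C \<noteq> {}) \<longleftrightarrow> (\<forall>u v. (u, v) \<in> parcs G \<longrightarrow> {u, v} \<inter> C \<noteq> {})"
    unfolding edges_def by blast
  then show ?thesis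
    by (simp add: vertex_cover_def)
qed

text \<open>Every edge occurs as two arcs, so the equivalence is applied in both orientations and
  excludes edges inside \<open>A\<close> as well as inside \<open>B\<close>.\<close>

lemma bipartition_iff:
  "bipartition G A B \<longleftrightarrow> A \<union> B = pverts G \<and> A \<inter> B = {} \<and>
    (\<forall>u v. (u, v) \<in> parcs G \<longrightarrow> (u \<in> A \<longleftrightarrow> v \<in> B))" (is "?L \<longleftrightarrow> ?R")
proof
  assume ?L
  then show ?R
    by (auto simp: bipartition_def edges_def) (metis disjoint_iff doubleton_eq_iff)+
next
  assume R: ?R
  have "\<exists>x\<in>A. \<exists>y\<in>B. {u, v} = {x, y}" if "(u, v) \<in> parcs G" for u v
    using R that in_arcsD1[OF that] in_arcsD2[OF that] parcs_sym[OF that] by (metis UnE insert_commute)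
  with R show ?L
    by (auto simp: bipartition_def edges_def)
qed

lemma bipartition_edgeE:
  assumes "bipartition G A B" "e \<in> edges G"
  obtains u v where "u \<in> A" "v \<in> B" "e = {u, v}"
proof -
  have "\<exists>u\<in>A. \<exists>v\<in>B. e = {u, v}"
    using assms unfolding bipartition_def by simp
  with that show ?thesis by blast
qed

lemma bipartition_commute: "bipartition G A B \<Longrightarrow> bipartition G B A"
  unfolding bipartition_iff using parcs_sym by (metis Int_commute Un_commute)

lemma bipartition_vertex_cover: "bipartition G A B \<Longrightarrow> vertex_cover G A"
  using in_arcsD1 in_arcsD2 by (fastforce simp: bipartition_iff vertex_cover_iff)

lemma vertex_cover_bipartiteI:
  assumes bip: "bipartition G A B" and sub: "C \<subseteq> A \<union> B"
    and cov: "\<And>u v. u \<in> A \<Longrightarrow> v \<in> B \<Longrightarrow> (u, v) \<in> parcs G \<Longrightarrow> u \<in> C \<or> v \<in> C"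
  shows "vertex_cover G C"
  unfolding vertex_cover_iff
proof (intro conjI allI impI)
  show "C \<subseteq> pverts G"
    using bip sub by (simp add: bipartition_def)
  fix u v
  assume uv: "(u, v) \<in> parcs G"
  then have "u \<in> A \<and> v \<in> B \<or> v \<in> A \<and> u \<in> B"
    using bip parcs_sym in_arcsD1 unfolding bipartition_iff by (metis UnE)
  then show "u \<in> C \<or> v \<in> C"
    using cov uv parcs_sym by blast
qed

lemma min_vertex_cover_subset:
  assumes "vertex_cover G C"
  obtains D where "D \<in> min_vertex_covers G" "D \<subseteq> C"
proof -
  have "finite C"
    using assms by (auto simp: vertex_cover_def intro: finite_subset)
  then have "\<exists>D \<in> min_vertex_covers G. D \<subseteq> C"
    using assms
  proof (induction C rule: finite_psubset_induct)
    case (psubset C)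
    show ?case
    proof (cases "C \<in> min_vertex_covers G")
      case False
      then obtain D where D: "D \<subset> C" "vertex_cover G D"
        using psubset.prems by (auto simp: min_vertex_covers_def)
      with psubset.IH[OF D] show ?thesis by blast
    qed blast
  qed
  with that show ?thesis by blast
qed

section \<open>Counting along a perfect matching\<close>

text \<open>The edges of \<open>M\<close> partition the vertex set, so their traces partition
  \<open>C\<close>.\<close>

lemma card_perfect_matching:
  assumes M: "perfect_matching G M" and C: "C \<subseteq> pverts G"
  shows "finite M" "card C = (\<Sum>e\<in>M. card (e \<inter> C))"
proof -
  have fin: "finite e" if "e \<in> M" for e
    using M that by (auto simp: perfect_matching_def edges_def)
  show finM: "finite M"
    using M by (auto simp: perfect_matching_def intro: finite_UnionD)
  have disj: "e \<inter> e' = {}" if "e \<in> M" "e' \<in> M" "e \<noteq> e'" for e e'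
    using M that by (auto simp: perfect_matching_def pairwise_def disjnt_def)
  have "C = (\<Union>e\<in>M. e \<inter> C)"
    using M C by (auto simp: perfect_matching_def)
  then have "card C = card (\<Union>e\<in>M. e \<inter> C)" by simp
  also have "\<dots> = (\<Sum>e\<in>M. card (e \<inter> C))"
  proof (intro card_UN_disjoint ballI impI)
    fix e e'
    assume "e \<in> M" "e' \<in> M" "e \<noteq> e'"
    from disj[OF this] show "e \<inter> C \<inter> (e' \<inter> C) = {}" by blast
  qed (use finM fin in auto)
  finally show "card C = (\<Sum>e\<in>M. card (e \<inter> C))" .
qed

lemma vertex_cover_card_edge:
  assumes "vertex_cover G C" "e \<in> edges G"
  shows "card (e \<inter> C) \<ge> 1"
proof -
  have "finite (e \<inter> C)"
    using assms by (auto simp: edges_def)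
  then show ?thesis
    using assms by (auto simp: vertex_cover_def Suc_le_eq card_gt_0_iff)
qed

text \<open>Every summand \<open>card (e \<inter> C)\<close> is at least 1, so the sum is at least
  \<open>card M\<close>, with equality only if every summand is 1.\<close>

lemma vertex_cover_card_perfect_matching:
  assumes "perfect_matching G M" "vertex_cover G C"
  shows "card M \<le> card C"
    and "card C = card M \<Longrightarrow> e \<in> M \<Longrightarrow> card (e \<inter> C) = 1"
proof -
  have C: "C \<subseteq> pverts G"
    using assms by (simp add: vertex_cover_def)
  note card_C = card_perfect_matching[OF assms(1) C]
  have ge: "card (e \<inter> C) \<ge> 1" if "e \<in> M" for e
    using that assms by (intro vertex_cover_card_edge) (auto simp: perfect_matching_def)
  show "card M \<le> card C"
    using sum_mono[of M "\<lambda>_. 1", OF ge] card_C by simp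
  show "card (e \<inter> C) = 1" if "card C = card M" "e \<in> M"
  proof (rule ccontr)
    assume "card (e \<inter> C) \<noteq> 1"
    with ge that have "(\<Sum>e\<in>M. 1) < (\<Sum>e\<in>M. card (e \<inter> C))"
      by (intro sum_strict_mono_ex1 card_C bexI[of _ e]) (auto simp: le_neq_implies_less)
    with that card_C show False by simp
  qed
qed

lemma card_bipartition_perfect_matching:
  assumes "bipartition G A B" "perfect_matching G M"
  shows "card A = card M"
proof -
  have "card (e \<inter> A) = 1" if "e \<in> M" for e
  proof -
    have "e \<in> edges G"
      using assms(2) that by (auto simp: perfect_matching_def)
    with assms(1) obtain u v where "u \<in> A" "v \<in> B" "e = {u, v}"
      by (rule bipartition_edgeE)
    then have "e \<inter> A = {u}"
      using assms by (auto simp: bipartition_def)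
    then show ?thesis by simp
  qed
  moreover have "A \<subseteq> pverts G"
    using assms by (auto simp: bipartition_def)
  ultimately show ?thesis
    using card_perfect_matching(2)[OF assms(2)] by simp
qed

section \<open>Matching-covered bipartite graphs and their small vertex covers\<close>

lemma matching_covered_imp_vertex_covers:
  assumes bip: "bipartition G A B" and mc: "matching_covered G"
  shows "card A = card B"
    and "vertex_cover G C \<Longrightarrow> card C \<le> card A \<Longrightarrow> C = A \<or> C = B"
proof -
  have conn: "pverts G \<noteq> {}" "\<And>u v. u \<in> pverts G \<Longrightarrow> v \<in> pverts G \<Longrightarrow> (u, v) \<in> (parcs G)\<^sup>*"
    using mc by (auto simp: matching_covered_def connected_iff_rtrancl)
  \<comment> \<open>Two distinct vertices joined by a path supply an edge, and hence at least one
    perfect matching to compare the parts with.\<close>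
  obtain u v where "u \<in> pverts G" "v \<in> pverts G" "u \<noteq> v"
    using mc conn(1) unfolding matching_covered_def by blast
  then obtain w where "(u, w) \<in> parcs G"
    using conn(2) by (metis converse_rtranclE)
  then obtain M where M: "perfect_matching G M"
    using mc edge_iff unfolding matching_covered_def by blast
  show AB: "card A = card B"
    using card_bipartition_perfect_matching M bip bipartition_commute by metis
  assume C: "vertex_cover G C" "card C \<le> card A"
  have edge: "(u \<in> C) \<noteq> (v \<in> C)" if uv: "(u, v) \<in> parcs G" for u v
  proof -
    obtain N where N: "perfect_matching G N" "{u, v} \<in> N"
      using mc uv edge_iff unfolding matching_covered_def by blast
    have "card N = card A"
      using card_bipartition_perfect_matching[OF bip N(1)] by simp
    then have "card ({u, v} \<inter> C) = 1"
      using vertex_cover_card_perfect_matching[OF N(1) C(1)] N(2) C(2) by simp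
    moreover have "u \<noteq> v"
      using uv pair_no_loops by force
    ultimately show ?thesis
      by (cases "u \<in> C"; cases "v \<in> C") auto
  qed
  obtain r where r: "r \<in> pverts G"
    using conn(1) by blast
  \<comment> \<open>Along an arc, membership in \<open>C\<close> and membership in \<open>A\<close>
    both flip, so their agreement is constant on paths from \<open>r\<close>. Agreement everywhere
    means \<open>C = A\<close>, disagreement everywhere means \<open>C = B\<close>.\<close>
  have inv: "(v \<in> C \<longleftrightarrow> v \<in> A) \<longleftrightarrow> (r \<in> C \<longleftrightarrow> r \<in> A)" if "v \<in> pverts G" for v
    using conn(2)[OF r that]
  proof (induction rule: rtrancl_induct)
    case (step y z)
    then have "(y \<in> A) \<noteq> (z \<in> A)"
      using bip in_arcsD1[OF step.hyps(2)] in_arcsD2[OF step.hyps(2)]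
      by (auto simp: bipartition_iff)
    with edge[OF step.hyps(2)] step.IH show ?case by blast
  qed simp
  have "C \<subseteq> pverts G" "A \<union> B = pverts G" "A \<inter> B = {}"
    using C bip by (auto simp: vertex_cover_def bipartition_def)
  then show "C = A \<or> C = B"
    using inv by (cases "r \<in> C \<longleftrightarrow> r \<in> A"; simp) blast+
qed

lemma vertex_covers_imp_matching_covered:
  assumes bip: "bipartition G A B" and ne: "pverts G \<noteq> {}" and card_eq: "card A = card B"
    and cover: "\<And>C. vertex_cover G C \<Longrightarrow> card C \<le> card A \<Longrightarrow> C = A \<or> C = B"
  shows "matching_covered G"
proof -
  have AB: "A \<union> B = pverts G" "A \<inter> B = {}" and arc: "\<And>u v. (u, v) \<in> parcs G \<Longrightarrow> u \<in> A \<longleftrightarrow> v \<in> B"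
    using bip by (auto simp: bipartition_iff)
  have fin: "finite A" "finite B"
    using AB by (metis finite_Un pair_finite_verts)+
  have "A \<noteq> {}"
    using fin card_eq AB ne by auto
  then obtain r where r: "r \<in> A" by blast
  \<comment> \<open>Without surplus, exchanging \<open>S\<close> for its neighbours gives a cover of
    size at most \<open>card A\<close>. It lacks the elements of \<open>S\<close>, so it is not
    \<open>A\<close>; it keeps an element of \<open>A - S\<close>, so it is not
    \<open>B\<close>.\<close>
  have surplus: "card S < card (parcs G `` S)" if S: "S \<subseteq> A" "S \<noteq> {}" "S \<noteq> A" for S
  proof (rule ccontr)
    assume "\<not> card S < card (parcs G `` S)"
    moreover have NB: "parcs G `` S \<subseteq> B"
      using S arc by blast
    have "card ((A - S) \<union> parcs G `` S) = card (A - S) + card (parcs G `` S)"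
      using NB AB fin by (intro card_Un_disjoint) (auto intro: finite_subset)
    moreover have "card (A - S) = card A - card S" "card S \<le> card A"
      using S fin by (auto simp: card_Diff_subset finite_subset card_mono)
    ultimately have "card ((A - S) \<union> parcs G `` S) \<le> card A"
      by linarith
    moreover have "vertex_cover G ((A - S) \<union> parcs G `` S)"
      using NB AB arc parcs_sym by (intro vertex_cover_bipartiteI[OF bip]) blast+
    ultimately have "(A - S) \<union> parcs G `` S = A \<or> (A - S) \<union> parcs G `` S = B"
      by (intro cover)
    with S NB AB show False by blast
  qed
  have "Digraph_Component.connected (with_proj G)"
  proof -
    \<comment> \<open>The sizes of the two covers below add up to \<open>card A + card B\<close>, so one of them is small.\<close>
    define S where "S = (parcs G)\<^sup>* `` {r}"
    have closed: "v \<in> S \<longleftrightarrow> u \<in> S" if "(u, v) \<in> parcs G" for u v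
      using that parcs_sym[OF that] unfolding S_def by (auto intro: rtrancl_into_rtrancl)
    \<comment> \<open>No arc leaves the component \<open>S\<close>, so one part may be used inside
      \<open>S\<close> and the other part outside it.\<close>
    have vc: "vertex_cover G ((A - S) \<union> (B \<inter> S))" "vertex_cover G ((B - S) \<union> (A \<inter> S))"
      using closed by (intro vertex_cover_bipartiteI[OF bip]; blast)+
    have "card ((A - S) \<union> (B \<inter> S)) = card (A - S) + card (B \<inter> S)"
      "card ((B - S) \<union> (A \<inter> S)) = card (B - S) + card (A \<inter> S)"
      using AB fin by (intro card_Un_disjoint; auto)+
    moreover have "card A = card (A \<inter> S) + card (A - S)" "card B = card (B \<inter> S) + card (B - S)"
      using fin by (auto simp: card_Int_Diff)
    ultimately have "card ((A - S) \<union> (B \<inter> S)) \<le> card A \<or> card ((B - S) \<union> (A \<inter> S)) \<le> card A"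
      using card_eq by linarith
    then have "(A - S) \<union> (B \<inter> S) = A \<or> (A - S) \<union> (B \<inter> S) = B \<or>
       (B - S) \<union> (A \<inter> S) = A \<or> (B - S) \<union> (A \<inter> S) = B"
      using cover vc by blast
    moreover have "r \<in> S"
      by (simp add: S_def)
    \<comment> \<open>As \<open>r\<close> lies in \<open>A \<inter> S\<close>, the first cover can
      only be \<open>B\<close> and the second only \<open>A\<close>; either equality puts both parts
      inside \<open>S\<close>.\<close>
    ultimately have "pverts G \<subseteq> S"
      using r AB by blast
    then have "(r, v) \<in> (parcs G)\<^sup>*" if "v \<in> pverts G" for v
      using that by (auto simp: S_def)
    moreover have "sym ((parcs G)\<^sup>*)"
      using parcs_sym by (intro sym_rtrancl) (auto simp: sym_def)
    ultimately show ?thesis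
      using ne unfolding connected_iff_rtrancl by (meson rtrancl_trans symD)
  qed
  moreover have "\<not> (\<exists>v. pverts G = {v})"
  proof
    assume "\<exists>v. pverts G = {v}"
    \<comment> \<open>Parity: parts of equal size give an even number of vertices.\<close>
    moreover have "card (pverts G) = card A + card B"
      using AB fin by (metis card_Un_disjoint)
    ultimately show False
      using card_eq by auto presburger
  qed
  moreover have "\<exists>M. perfect_matching G M \<and> e \<in> M" if e: "e \<in> edges G" for e
  proof -
    obtain x y where xy: "x \<in> A" "y \<in> B" "e = {x, y}"
      using bip e by (rule bipartition_edgeE)
    then have xy_arc: "(x, y) \<in> parcs G"
      using e edge_iff by simp
    define R where "R = parcs G - UNIV \<times> {y}"
    have RS: "R `` S = parcs G `` S - {y}" for S
      by (auto simp: R_def)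
    \<comment> \<open>A nonempty \<open>S\<close> is proper in \<open>A\<close> because it misses
      \<open>x\<close>, so it has a surplus of at least one neighbour, which pays for the loss of
      \<open>y\<close>.\<close>
    have "card S \<le> card (R `` S)" if S: "S \<subseteq> A - {x}" for S
    proof (cases "S = {}")
      case False
      then have "card S < card (parcs G `` S)"
        using S xy by (intro surplus) auto
      moreover have "card (parcs G `` S) \<le> Suc (card (R `` S))"
        unfolding RS by (simp add: card_Diff_singleton_if del: One_nat_def) linarith
      ultimately show ?thesis by linarith
    qed simp
    then obtain f where f: "inj_on f (A - {x})" "\<And>u. u \<in> A - {x} \<Longrightarrow> (u, f u) \<in> R"
      using hall_marriage[of R "A - {x}"] fin by (auto simp: R_def)
    define g where "g = f(x := y)"
    have g_arc: "(u, g u) \<in> parcs G" if "u \<in> A" for u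
      using f(2)[of u] that xy_arc by (auto simp: g_def R_def)
    \<comment> \<open>\<open>R\<close> contains no pair ending in \<open>y\<close>, so
      \<open>f\<close> never takes the value given to \<open>x\<close>.\<close>
    have inj: "inj_on g A"
      using f unfolding g_def inj_on_def R_def by (auto split: if_splits)
    have "g ` A \<subseteq> B"
      using g_arc arc by blast
    then have img: "g ` A = B"
      using inj fin card_eq by (metis card_image card_subset_eq)
    define M where "M = (\<lambda>u. {u, g u}) ` A"
    have "M \<subseteq> edges G"
      using g_arc by (auto simp: M_def edge_iff)
    moreover have "\<Union>M = pverts G"
      using img AB by (auto simp: M_def)
    moreover have "pairwise disjnt M"
    proof (rule pairwiseI)
      fix p q
      assume "p \<in> M" "q \<in> M" "p \<noteq> q"
      then obtain u v where uv: "u \<in> A" "v \<in> A" "p = {u, g u}" "q = {v, g v}" "u \<noteq> v"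
        by (auto simp: M_def)
      moreover have "g u \<in> B" "g v \<in> B" "g u \<noteq> g v"
        using uv img inj by (auto dest: inj_onD)
      ultimately show "disjnt p q"
        using AB by (auto simp: disjnt_def)
    qed
    moreover have "e \<in> M"
      using xy by (auto simp: M_def g_def)
    ultimately show ?thesis
      unfolding perfect_matching_def by blast
  qed
  ultimately show ?thesis
    unfolding matching_covered_def by blast
qed

end

section \<open>Vertex sets and covers in the parallelization\<close>

text \<open>The preimage of \<open>C\<close> under the projection \<open>(i, r) \<mapsto> i\<close>.
  Its size is the weight of \<open>C\<close>, which turns the system into a comparison of cover
  sizes.\<close>

definition fibres :: "('a \<Rightarrow> nat) \<Rightarrow> 'a set \<Rightarrow> ('a \<times> nat) set" where
  "fibres a C = (SIGMA i : C. {1..a i})"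

lemma card_fibres: "finite C \<Longrightarrow> card (fibres a C) = (\<Sum>i\<in>C. a i)"
  by (simp add: fibres_def)

lemma pverts_parallelization: "pverts (parallelization G a) = fibres a (pverts G)"
  by (simp add: parallelization_def fibres_def)

lemma parcs_parallelization:
  "((i, r), (j, s)) \<in> parcs (parallelization G a) \<longleftrightarrow>
    (i, j) \<in> parcs G \<and> r \<in> {1..a i} \<and> s \<in> {1..a j}"
  by (simp add: parallelization_def)

context pair_graph
begin

lemma bipartition_fibres:
  assumes "bipartition G A B"
  shows "bipartition (parallelization G a) (fibres a A) (fibres a B)"
  using assms pair_graph.bipartition_iff[OF pair_graph_parallelization[OF pair_graph]]
  by (auto simp: bipartition_iff pverts_parallelization parcs_parallelization fibres_def)

lemma vertex_cover_fibres:
  assumes "vertex_cover G C"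
  shows "vertex_cover (parallelization G a) (fibres a C)"
  using assms pair_graph.vertex_cover_iff[OF pair_graph_parallelization[OF pair_graph]]
  by (auto simp: vertex_cover_iff pverts_parallelization parcs_parallelization fibres_def)

text \<open>If both ends of an arc of \<open>G\<close> had a copy outside \<open>C\<close>, these
  two copies would form an uncovered edge. Vertices of weight zero enter \<open>D\<close>
  vacuously.\<close>

lemma vertex_cover_full_fibres:
  assumes "vertex_cover (parallelization G a) C"
  obtains D where "vertex_cover G D" "fibres a D \<subseteq> C"
proof
  let ?D = "{i \<in> pverts G. \<forall>r\<in>{1..a i}. (i, r) \<in> C}"
  show "vertex_cover G ?D"
    using assms in_arcsD1 in_arcsD2
    unfolding vertex_cover_iff pair_graph.vertex_cover_iff[OF pair_graph_parallelization[OF pair_graph]]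
      parcs_parallelization split_paired_All by blast
  show "fibres a ?D \<subseteq> C"
    by (auto simp: fibres_def)
qed

text \<open>The copies determine \<open>C\<close> on the support only. A vertex of \<open>A\<close>
  of weight zero has a neighbour in the support; that neighbour is in \<open>B\<close>, hence not in
  \<open>C\<close>, so the vertex itself must be in \<open>C\<close>. Minimality then turns
  \<open>A \<subseteq> C\<close> into equality.\<close>

lemma min_vertex_cover_eq_part_if_fibres_eq:
  assumes bip: "bipartition G A B" and dom: "dominating_set G (supp (pverts G) a)"
    and C: "C \<in> min_vertex_covers G" and eq: "fibres a C = fibres a A"
  shows "C = A"
proof -
  have sub: "C \<subseteq> pverts G" and cov: "\<And>u v. (u, v) \<in> parcs G \<Longrightarrow> u \<in> C \<or> v \<in> C"
    using C by (auto simp: min_vertex_covers_def vertex_cover_iff)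
  have AB: "A \<union> B = pverts G" "A \<inter> B = {}"
    and arc: "\<And>u v. (u, v) \<in> parcs G \<Longrightarrow> u \<in> A \<longleftrightarrow> v \<in> B"
    using bip by (auto simp: bipartition_iff)
  have supp_eq: "i \<in> C \<longleftrightarrow> i \<in> A" if "a i \<noteq> 0" for i
  proof -
    have "(i, 1) \<in> fibres a D \<longleftrightarrow> i \<in> D" for D
      using that by (auto simp: fibres_def)
    with eq show ?thesis by metis
  qed
  have "A \<subseteq> C"
  proof
    fix i
    assume i: "i \<in> A"
    show "i \<in> C"
    proof (rule ccontr)
      assume "i \<notin> C"
      with supp_eq i have "a i = 0" by blast
      then have "i \<in> pverts G - supp (pverts G) a"
        using i AB by (auto simp: supp_def)
      then obtain j where j: "a j \<noteq> 0" "(j, i) \<in> parcs G"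
        using dom unfolding dominating_set_def supp_def edge_iff by blast
      then have "j \<in> B"
        using arc parcs_sym i by blast
      with AB supp_eq j have "j \<notin> C" by blast
      with cov j \<open>i \<notin> C\<close> show False by blast
    qed
  qed
  with C bipartition_vertex_cover[OF bip] show "C = A"
    by (auto simp: min_vertex_covers_def)
qed

text \<open>If \<open>v\<close> were undominated, replacing it in \<open>A\<close> by its
  neighbours, all of weight zero, would give a cover no heavier than \<open>A\<close>. It misses
  \<open>v\<close>, so it contains \<open>B\<close>; thus \<open>B\<close> consists of neighbours of
  \<open>v\<close> and has weight zero.\<close>

lemma supp_dominates_part:
  assumes bip: "bipartition G A B" and ne: "(\<Sum>i\<in>B. a i) \<noteq> 0"
    and cover: "\<And>C. vertex_cover G C \<Longrightarrow> (\<Sum>i\<in>C. a i) \<le> (\<Sum>i\<in>A. a i) \<Longrightarrow> A \<subseteq> C \<or> B \<subseteq> C"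
    and v: "v \<in> A"
  shows "\<exists>u \<in> supp (pverts G) a. (u, v) \<in> parcs G \<or> u = v"
proof (rule ccontr)
  assume none: "\<not> ?thesis"
  have AB: "A \<union> B = pverts G" "A \<inter> B = {}"
    and arc: "\<And>u v. (u, v) \<in> parcs G \<Longrightarrow> u \<in> A \<longleftrightarrow> v \<in> B"
    using bip by (auto simp: bipartition_iff)
  let ?N = "parcs G `` {v}"
  have fin: "finite A" "finite ?N"
    using AB by (metis finite_Un pair_finite_verts) (simp add: finite_Image)
  have N: "?N \<subseteq> B"
    using v arc by blast
  have zero: "a u = 0" if "u \<in> ?N" for u
    using none that in_arcsD2 parcs_sym unfolding supp_def by blast
  let ?C = "(A - {v}) \<union> ?N"
  have "vertex_cover G ?C"
    using N by (intro vertex_cover_bipartiteI[OF bip]) blast+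
  moreover have "(\<Sum>i\<in>?C. a i) \<le> (\<Sum>i\<in>A. a i)"
  proof -
    have "(\<Sum>i\<in>?C. a i) = (\<Sum>i\<in>A - {v}. a i) + (\<Sum>i\<in>?N. a i)"
      using fin N AB by (intro sum.union_disjoint) auto
    also have "\<dots> = (\<Sum>i\<in>A - {v}. a i)"
      using zero by simp
    also have "\<dots> \<le> (\<Sum>i\<in>A. a i)"
      using fin by (intro sum_mono2) auto
    finally show ?thesis .
  qed
  ultimately have "A \<subseteq> ?C \<or> B \<subseteq> ?C"
    by (rule cover)
  then have "B \<subseteq> ?N"
    using v N AB by blast
  with zero ne show False
    by (metis sum.neutral subsetD)
qed

section \<open>The system against domination and matching-coverage\<close>

lemma system_iff_dominating_matching_covered:
  assumes bip: "bipartition G A B" and ne: "\<exists>i\<in>pverts G. a i \<noteq> 0"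
  shows "((\<Sum>i\<in>A. a i) = (\<Sum>i\<in>B. a i) \<and>
          (\<forall>C \<in> min_vertex_covers G. C \<noteq> A \<and> C \<noteq> B \<longrightarrow> (\<Sum>i\<in>C. a i) > (\<Sum>i\<in>A. a i)))
     \<longleftrightarrow> (dominating_set G (supp (pverts G) a) \<and> matching_covered (parallelization G a))"
    (is "?system \<longleftrightarrow> ?dom \<and> ?mc")
proof -
  interpret P: pair_graph "parallelization G a"
    by (rule pair_graph_parallelization[OF pair_graph])
  have AB: "A \<union> B = pverts G" "A \<inter> B = {}"
    using bip by (auto simp: bipartition_def)
  have fin: "finite A" "finite B"
    using AB by (metis finite_Un pair_finite_verts)+
  note bipP = bipartition_fibres[OF bip, of a]
  note cards = card_fibres[OF fin(1), of a] card_fibres[OF fin(2), of a]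
  show ?thesis
  proof
    assume sys: ?system
    \<comment> \<open>The system restated for arbitrary covers: a minimal cover inside
      \<open>C\<close> is no heavier than \<open>C\<close>, so it must be \<open>A\<close> or
      \<open>B\<close>.\<close>
    have cover: "A \<subseteq> C \<or> B \<subseteq> C"
      if C: "vertex_cover G C" "(\<Sum>i\<in>C. a i) \<le> (\<Sum>i\<in>A. a i)" for C
    proof -
      obtain D where D: "D \<in> min_vertex_covers G" "D \<subseteq> C"
        using min_vertex_cover_subset[OF C(1)] .
      have "finite C"
        using C by (auto simp: vertex_cover_def intro: finite_subset)
      then have "(\<Sum>i\<in>D. a i) \<le> (\<Sum>i\<in>C. a i)"
        using D by (intro sum_mono2) auto
      with C sys D have "D = A \<or> D = B"
        by (meson leD order_trans)
      with D show ?thesis by blast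
    qed
    obtain i where "i \<in> A \<union> B" "a i \<noteq> 0"
      using ne AB by blast
    then have "(\<Sum>i\<in>A. a i) \<noteq> 0 \<or> (\<Sum>i\<in>B. a i) \<noteq> 0"
      using fin by (metis UnE sum_eq_0_iff)
    then have pos: "(\<Sum>i\<in>A. a i) \<noteq> 0" "(\<Sum>i\<in>B. a i) \<noteq> 0"
      using sys by auto
    have ?dom
    proof -
      \<comment> \<open>The two parts are handled by the same lemma with \<open>A\<close> and
        \<open>B\<close> exchanged; equality of the two sums carries \<open>cover\<close>
        over.\<close>
      have "\<exists>u \<in> supp (pverts G) a. (u, v) \<in> parcs G \<or> u = v" if "v \<in> pverts G" for v
        using that supp_dominates_part[OF bip pos(2) cover, of v]
          supp_dominates_part[OF bipartition_commute[OF bip] pos(1), of v] cover sys AB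
        by (metis UnE)
      then show ?thesis
        by (auto simp: dominating_set_def edge_iff supp_def)
    qed
    moreover have ?mc
    proof (rule P.vertex_covers_imp_matching_covered[OF bipP])
      show "pverts (parallelization G a) \<noteq> {}"
        using ne by (fastforce simp: pverts_parallelization fibres_def)
      show "card (fibres a A) = card (fibres a B)"
        using sys cards by simp
      fix C
      assume C: "vertex_cover (parallelization G a) C" "card C \<le> card (fibres a A)"
      obtain D where D: "vertex_cover G D" "fibres a D \<subseteq> C"
        using vertex_cover_full_fibres[OF C(1)] .
      have finC: "finite C" "finite D"
        using C D by (auto simp: vertex_cover_def intro: finite_subset)
      have "(\<Sum>i\<in>D. a i) \<le> (\<Sum>i\<in>A. a i)"
        using card_mono[OF finC(1) D(2)] C(2) card_fibres[OF finC(2)] cards by simp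
      then have "A \<subseteq> D \<or> B \<subseteq> D"
        using cover D by blast
      then have "fibres a A \<subseteq> C \<or> fibres a B \<subseteq> C"
        using D by (auto simp: fibres_def)
      moreover have "card (fibres a A) = card (fibres a B)"
        using sys cards by simp
      \<comment> \<open>\<open>C\<close> contains all copies of one part and is no larger than that
        set of copies, so the two coincide.\<close>
      ultimately show "C = fibres a A \<or> C = fibres a B"
        using C(2) finC card_seteq by metis
    qed
    ultimately show "?dom \<and> ?mc" ..
  next
    assume R: "?dom \<and> ?mc"
    note mc = P.matching_covered_imp_vertex_covers[OF bipP conjunct2[OF R]]
    have "(\<Sum>i\<in>C. a i) > (\<Sum>i\<in>A. a i)"
      if C: "C \<in> min_vertex_covers G" "C \<noteq> A" "C \<noteq> B" for C
    proof (rule ccontr)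
      \<comment> \<open>The copies of a light \<open>C\<close> form a small cover of the
        parallelization, hence are exactly the copies of \<open>A\<close> or of \<open>B\<close>;
        domination then recovers \<open>C\<close> itself as that part.\<close>
      assume le: "\<not> ?thesis"
      have vc: "vertex_cover G C"
        using C by (simp add: min_vertex_covers_def)
      then have "finite C"
        by (auto simp: vertex_cover_def intro: finite_subset)
      with le cards have "card (fibres a C) \<le> card (fibres a A)"
        by (simp add: card_fibres)
      then have "fibres a C = fibres a A \<or> fibres a C = fibres a B"
        using mc(2) vertex_cover_fibres[OF vc] by blast
      then show False
        using min_vertex_cover_eq_part_if_fibres_eq bip bipartition_commute[OF bip] R C by blast
    qed
    with mc(1) cards show ?system by simp
  qed
qed

end

theorem theorem2p6:
  fixes n :: nat and G :: "nat pair_pre_digraph" and A B :: "nat set" and a :: "nat \<Rightarrow> nat"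
  assumes "n \<ge> 2"
    and "pair_graph G"
    and "pverts G = {1..n}"
    and "Digraph_Component.connected (with_proj G)"
    and "bipartition G A B"
    and "\<exists>i \<in> {1..n}. a i \<noteq> 0"
  shows "((\<Sum>i\<in>A. a i) = (\<Sum>i\<in>B. a i) \<and>
          (\<forall>C \<in> min_vertex_covers G. C \<noteq> A \<and> C \<noteq> B \<longrightarrow> (\<Sum>i\<in>C. a i) > (\<Sum>i\<in>A. a i)))
     \<longleftrightarrow> (dominating_set G (supp {1..n} a) \<and> matching_covered (parallelization G a))"
  using pair_graph.system_iff_dominating_matching_covered[of G A B a] assms by simp

end
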